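(* Let $X$ and $Y$ be independent normal random variables (that is, $(X,Y)$ is bivariate normal with correlation coefficient $\rho=0$), where $X$ has mean $\mu_X\in\mathbb{R}$ and variance $\sigma_X^2$, and $Y$ has mean $\mu_Y=0$ and variance $\sigma_Y^2$, with $\sigma_X,\sigma_Y>0$. Let $Z=XY$, let $n\geq1$ be an integer, let $Z_1,\ldots,Z_n$ be independent copies of $Z$, and let $S_n=\sum_{i=1}^n Z_i$. Then the probability density function of $S_n$ is given, for $x\in\mathbb{R}$, by $$f_{S_n}(x)=\frac{2^{(1-n)/2}}{(\sigma_X\sigma_Y)^{(n+1)/2}\sqrt{\pi}}\exp\bigg(-\frac{n\mu_X^2}{2\sigma_X^2}\bigg)\sum_{k=0}^{\infty}\frac{(n\mu_X^2/4)^k\,|x|^{(n-1)/2+k}}{k!\,\Gamma(n/2+k)\,\sigma_X^{3k}\sigma_Y^k}\,K_{\frac{n-1}{2}+k}\bigg(\frac{|x|}{\sigma_X\sigma_Y}\bigg).$$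
   Context: $K_\nu$ is the modified Bessel function of the second kind: for $\nu\in\mathbb{R}$ and $x>0$, $K_\nu(x)=\frac12\big(\frac{x}{2}\big)^\nu\int_0^\infty \exp\big(-t-\frac{x^2}{4t}\big)\,\frac{\mathrm{d}t}{t^{\nu+1}}$. At $x=0$ the terms $|x|^{(n-1)/2+k}K_{(n-1)/2+k}(|x|/(\sigma_X\sigma_Y))$ are understood as their limits as $x\to0$ (equal to $+\infty$ when $n=1$, $k=0$). The convention $0^0=1$ is used. *)

theory Defs
  imports "HOL-Probability.Probability"
begin

text \<open>Modified Bessel function of the second kind. Only meaningful for \<^prop>\<open>x > 0\<close>, where
  the integrand is integrable for every real order.\<close>

definition bessel_K :: "real \<Rightarrow> real \<Rightarrow> real" where
  "bessel_K \<nu> x =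
     1 / 2 * (x / 2) powr \<nu> *
       (LINT t:{0<..}|lborel. exp (- t - x\<^sup>2 / (4 * t)) / t powr (\<nu> + 1))"

text \<open>The function sending \<open>x\<close> to \<open>|x|\<^sup>\<nu> K\<^sub>\<nu>(|x| / s)\<close>, extended to \<open>x = 0\<close> by its limit.
  The limit is taken in \<^typ>\<open>ennreal\<close> because it is infinite when \<open>\<nu> = 0\<close>.\<close>

definition powr_bessel_K :: "real \<Rightarrow> real \<Rightarrow> real \<Rightarrow> ennreal" where
  "powr_bessel_K \<nu> s x =
     (if x = 0 then Lim (at 0) (\<lambda>y. ennreal (\<bar>y\<bar> powr \<nu> * bessel_K \<nu> (\<bar>y\<bar> / s)))
      else ennreal (\<bar>x\<bar> powr \<nu> * bessel_K \<nu> (\<bar>x\<bar> / s)))"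

text \<open>The parameters are the number \<open>n\<close> of summands, the mean of \<open>X\<close>, and the standard
  deviations of \<open>X\<close> and \<open>Y\<close>. For \<open>n = 1\<close> the value at \<open>0\<close> is infinite.\<close>

definition sum_product_normal_density ::
  "nat \<Rightarrow> real \<Rightarrow> real \<Rightarrow> real \<Rightarrow> real \<Rightarrow> ennreal" where
  "sum_product_normal_density n \<mu>X \<sigma>X \<sigma>Y x =
     ennreal (2 powr ((1 - real n) / 2) / ((\<sigma>X * \<sigma>Y) powr ((real n + 1) / 2) * sqrt pi)
              * exp (- (real n * \<mu>X\<^sup>2 / (2 * \<sigma>X\<^sup>2)))) *
     (\<Sum>k. ennreal ((real n * \<mu>X\<^sup>2 / 4) ^ k
                   / (fact k * Gamma (real n / 2 + real k) * \<sigma>X ^ (3 * k) * \<sigma>Y ^ k))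
           * powr_bessel_K ((real n - 1) / 2 + real k) (\<sigma>X * \<sigma>Y) x)"

end

theory Submission
  imports Defs
begin

text \<open>
  Given \<open>X\<close>, the product \<open>X Y\<close> is centred normal, so its characteristic function is a Gaussian
  integral. With \<open>s = \<sigma>\<^sub>X \<sigma>\<^sub>Y\<close>, \<open>D = 1 + s\<^sup>2 t\<^sup>2\<close> and \<open>l = n \<mu>\<^sub>X\<^sup>2 / (2 \<sigma>\<^sub>X\<^sup>2)\<close>, its \<open>n\<close>-th power is
  \<open>exp (l / D - l) / D powr (n / 2)\<close>. Expanding \<open>exp (l / D)\<close> shows that this is also the
  characteristic function of \<open>s (2 V)\<^bsup>1/2\<^esup> W\<close>, where \<open>W\<close> is standard normal and \<open>V\<close> is an independent
  Poisson mixture, with parameter \<open>l\<close>, of Gamma distributions of shape \<open>n / 2 + k\<close>. The density of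
  this normal scale mixture is the Bessel series: the \<open>k\<close>-th Gamma integral against the normal
  density is the integral for \<open>K\<^sub>\<nu>\<close> with \<open>\<nu> = (n - 1) / 2 + k\<close> after the inversion \<open>t = c / u\<close>.
\<close>


section \<open>Normal scale mixtures and the product of two independent normals\<close>

text \<open>Fubini integrates out the standard normal factor first, leaving its characteristic
  function at \<open>t * h v\<close>. Only the square of \<open>h v\<close> enters, so
  \<open>h\<close> may take either sign. It serves twice: for the law of \<open>X\<close> with scale
  \<open>\<sigma>Y * x\<close>, and for the Poisson-Gamma law with scale
  \<open>s * sqrt (2 * v)\<close>.\<close>

lemma char_normal_scale_mixture:
  fixes G :: "real measure"
  assumes "prob_space G" and G [measurable_cong]: "sets G = sets borel"
    and h [measurable]: "h \<in> borel_measurable borel"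
  shows "char (distr (G \<Otimes>\<^sub>M std_normal_distribution) borel (\<lambda>(v, y). h v * y)) t
    = of_real (LINT v|G. exp (- (t * h v)\<^sup>2 / 2))"
proof -
  interpret G: prob_space G by fact
  interpret S: prob_space std_normal_distribution
    by (rule prob_space_normal_density) simp
  interpret P: pair_prob_space G std_normal_distribution ..
  have meas: "(\<lambda>(v, y). iexp (t * (h v * y))) \<in> borel_measurable (G \<Otimes>\<^sub>M std_normal_distribution)"
    by measurable
  have int: "integrable (G \<Otimes>\<^sub>M std_normal_distribution) (\<lambda>(v, y). iexp (t * (h v * y)))"
    by (rule P.integrable_const_bound[where B=1]) (auto simp: meas)
  have "char (distr (G \<Otimes>\<^sub>M std_normal_distribution) borel (\<lambda>(v, y). h v * y)) t
      = (CLINT p|G \<Otimes>\<^sub>M std_normal_distribution. (\<lambda>(v, y). iexp (t * (h v * y))) p)"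
    unfolding char_def by (subst integral_distr) (auto simp: case_prod_unfold)
  also have "\<dots> = (CLINT v|G. CLINT y|std_normal_distribution. iexp (t * (h v * y)))"
    using P.integral_fst'[OF int] by simp
  also have "\<dots> = (CLINT v|G. char std_normal_distribution (t * h v))"
    by (simp add: char_def mult.assoc)
  also have "\<dots> = of_real (LINT v|G. exp (- (t * h v)\<^sup>2 / 2))"
    unfolding char_std_normal_distribution by (rule integral_complex_of_real)
  finally show ?thesis .
qed

text \<open>For fixed \<open>v\<close> the substitution \<open>x = h v * y\<close> carries the
  standard normal density to the one with standard deviation \<open>h v\<close>; Tonelli then
  exchanges \<open>v\<close> and \<open>x\<close>. Positivity is asked only where \<open>g\<close>
  is nonzero because the scale \<open>s * sqrt (2 * v)\<close> used later is positive only for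
  \<open>v > 0\<close>, where the mixing density lives.\<close>

lemma distr_normal_scale_mixture:
  fixes h :: "real \<Rightarrow> real" and g :: "real \<Rightarrow> ennreal"
  assumes g [measurable]: "g \<in> borel_measurable borel"
    and h [measurable]: "h \<in> borel_measurable borel"
    and pos: "\<And>v. g v \<noteq> 0 \<Longrightarrow> h v > 0"
  shows "distr (density lborel g \<Otimes>\<^sub>M std_normal_distribution) borel (\<lambda>(v, y). h v * y)
    = density lborel (\<lambda>x. \<integral>\<^sup>+v. g v * normal_density 0 (h v) x \<partial>lborel)" (is "?L = ?R")
proof (rule measure_eqI)
  fix A assume "A \<in> sets ?L"
  then have A [measurable]: "A \<in> sets borel" by simp
  interpret S: prob_space std_normal_distribution
    by (rule prob_space_normal_density) simp
  have nd [measurable]: "(\<lambda>(v, x). normal_density 0 (h v) x) \<in> borel_measurable (borel \<Otimes>\<^sub>M borel)"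
    unfolding normal_density_def by measurable
  have inner: "g v * (\<integral>\<^sup>+y. ennreal (std_normal_density y) * indicator A (h v * y) \<partial>lborel)
      = g v * (\<integral>\<^sup>+x. ennreal (normal_density 0 (h v) x) * indicator A x \<partial>lborel)" for v
  proof (cases "g v = 0")
    case False
    then have hv: "h v > 0" by (rule pos)
    have "(\<integral>\<^sup>+x. ennreal (normal_density 0 (h v) x) * indicator A x \<partial>lborel)
        = \<bar>h v\<bar> * (\<integral>\<^sup>+y. ennreal (normal_density 0 (h v) (0 + h v * y)) * indicator A (0 + h v * y) \<partial>lborel)"
      using hv by (intro nn_integral_real_affine) auto
    also have "\<dots> = (\<integral>\<^sup>+y. ennreal (h v) * (ennreal (normal_density 0 (h v) (h v * y)) * indicator A (h v * y)) \<partial>lborel)"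
      using hv by (subst nn_integral_cmult) auto
    also have "\<dots> = (\<integral>\<^sup>+y. ennreal (std_normal_density y) * indicator A (h v * y) \<partial>lborel)"
    proof (rule nn_integral_cong)
      fix y
      have "h v * normal_density 0 (h v) (h v * y) = std_normal_density y"
        using hv by (simp add: normal_density_def real_sqrt_mult power_mult_distrib)
      then show "ennreal (h v) * (ennreal (normal_density 0 (h v) (h v * y)) * indicator A (h v * y))
          = ennreal (std_normal_density y) * indicator A (h v * y)"
        using hv by (simp add: mult.assoc[symmetric] ennreal_mult'[symmetric])
    qed
    finally show ?thesis by simp
  qed simp
  have "emeasure ?L A = (\<integral>\<^sup>+p. indicator A ((\<lambda>(v, y). h v * y) p) \<partial>(density lborel g \<Otimes>\<^sub>M std_normal_distribution))"
    by (subst nn_integral_indicator[symmetric], simp, subst nn_integral_distr) auto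
  also have "\<dots> = (\<integral>\<^sup>+v. \<integral>\<^sup>+y. indicator A (h v * y) \<partial>std_normal_distribution \<partial>density lborel g)"
    by (subst S.nn_integral_fst[symmetric]) auto
  also have "\<dots> = (\<integral>\<^sup>+v. g v * (\<integral>\<^sup>+y. ennreal (std_normal_density y) * indicator A (h v * y) \<partial>lborel) \<partial>lborel)"
    by (subst nn_integral_density) (auto simp: nn_integral_density)
  also have "\<dots> = (\<integral>\<^sup>+v. \<integral>\<^sup>+x. g v * (ennreal (normal_density 0 (h v) x) * indicator A x) \<partial>lborel \<partial>lborel)"
    unfolding inner by (subst nn_integral_cmult) auto
  also have "\<dots> = (\<integral>\<^sup>+x. \<integral>\<^sup>+v. g v * (ennreal (normal_density 0 (h v) x) * indicator A x) \<partial>lborel \<partial>lborel)"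
    by (rule lborel_pair.Fubini') measurable
  also have "\<dots> = (\<integral>\<^sup>+x. (\<integral>\<^sup>+v. g v * normal_density 0 (h v) x \<partial>lborel) * indicator A x \<partial>lborel)"
    by (subst nn_integral_multc[symmetric]) (auto simp: mult.assoc)
  also have "\<dots> = emeasure ?R A"
    by (subst emeasure_density) auto
  finally show "emeasure ?L A = emeasure ?R A" .
qed simp

text \<open>Completing the square: with \<open>D = 1 + 2 * c * \<sigma>\<^sup>2\<close> the
  integrand is a constant times the normal density of mean \<open>\<mu> / D\<close> and standard
  deviation \<open>\<sigma> / sqrt D\<close>, which has total mass 1.\<close>

lemma normal_exp_square_integral:
  assumes "\<sigma> > 0" "c \<ge> 0"
  shows "(LINT x|density lborel (normal_density \<mu> \<sigma>). exp (- c * x\<^sup>2))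
    = exp (- c * \<mu>\<^sup>2 / (1 + 2 * c * \<sigma>\<^sup>2)) / sqrt (1 + 2 * c * \<sigma>\<^sup>2)"
proof -
  define D where "D = 1 + 2 * c * \<sigma>\<^sup>2"
  have D: "D > 0" using assms unfolding D_def by (simp add: add_pos_nonneg)
  have *: "normal_density \<mu> \<sigma> x * exp (- c * x\<^sup>2)
      = exp (- c * \<mu>\<^sup>2 / D) / sqrt D * normal_density (\<mu> / D) (\<sigma> / sqrt D) x" for x
  proof -
    have sq: "(\<sigma> / sqrt D)\<^sup>2 = \<sigma>\<^sup>2 / D" using D by (simp add: power_divide)
    \<comment> \<open>With \<open>c\<close> expressed through \<open>D\<close>, the completed square
      is a rational identity in \<open>D\<close> and \<open>\<sigma>\<close>.\<close>
    have c: "c = (D - 1) / (2 * \<sigma>\<^sup>2)" using assms by (simp add: D_def)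
    have "- (x - \<mu>)\<^sup>2 / (2 * \<sigma>\<^sup>2) - c * x\<^sup>2 = - c * \<mu>\<^sup>2 / D - (x - \<mu> / D)\<^sup>2 / (2 * (\<sigma>\<^sup>2 / D))"
      unfolding c using D assms(1) by (simp add: field_simps power2_eq_square)
    then have e: "exp (- (x - \<mu>)\<^sup>2 / (2 * \<sigma>\<^sup>2)) * exp (- c * x\<^sup>2)
       = exp (- c * \<mu>\<^sup>2 / D) * exp (- (x - \<mu> / D)\<^sup>2 / (2 * (\<sigma>\<^sup>2 / D)))"
      by (simp add: exp_add[symmetric])
    have s: "sqrt (2 * pi * (\<sigma>\<^sup>2 / D)) * sqrt D = sqrt (2 * pi * \<sigma>\<^sup>2)"
      using D by (simp add: real_sqrt_mult[symmetric])
    have "normal_density \<mu> \<sigma> x * exp (- c * x\<^sup>2)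
        = (exp (- (x - \<mu>)\<^sup>2 / (2 * \<sigma>\<^sup>2)) * exp (- c * x\<^sup>2)) / sqrt (2 * pi * \<sigma>\<^sup>2)"
      unfolding normal_density_def by simp
    also have "\<dots> = exp (- c * \<mu>\<^sup>2 / D) * exp (- (x - \<mu> / D)\<^sup>2 / (2 * (\<sigma>\<^sup>2 / D)))
        / (sqrt (2 * pi * (\<sigma>\<^sup>2 / D)) * sqrt D)"
      unfolding e s ..
    also have "\<dots> = exp (- c * \<mu>\<^sup>2 / D) / sqrt D * normal_density (\<mu> / D) (\<sigma> / sqrt D) x"
      unfolding normal_density_def sq by simp
    finally show ?thesis .
  qed
  have "(LINT x|density lborel (normal_density \<mu> \<sigma>). exp (- c * x\<^sup>2))
      = (LINT x|lborel. normal_density \<mu> \<sigma> x * exp (- c * x\<^sup>2))"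
    by (subst integral_density) auto
  also have "\<dots> = exp (- c * \<mu>\<^sup>2 / D) / sqrt D"
    unfolding * using D assms by simp
  finally show ?thesis by (simp add: D_def)
qed

text \<open>Since \<open>Y / \<sigma>\<close> is standard normal and independent of
  \<open>X\<close>, the product is a normal scale mixture with random scale
  \<open>\<sigma> * X\<close>, the form to which \<open>char_normal_scale_mixture\<close>
  applies.\<close>

lemma (in prob_space) distr_mult_normal:
  assumes \<sigma>: "\<sigma> > 0"
    and Y: "distributed M lborel Y (normal_density 0 \<sigma>)"
    and indep: "indep_var borel X borel Y"
  shows "distr M borel (\<lambda>\<omega>. X \<omega> * Y \<omega>)
    = distr (distr M borel X \<Otimes>\<^sub>M std_normal_distribution) borel (\<lambda>(x, y). \<sigma> * x * y)"
proof -
  have X [measurable]: "X \<in> borel_measurable M"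
    using indep by (auto simp: indep_var_distribution_eq)
  have Yb [measurable]: "Y \<in> borel_measurable M"
    using indep by (auto simp: indep_var_distribution_eq)
  have "indep_var borel ((\<lambda>x. x) \<circ> X) borel ((\<lambda>y. y / \<sigma>) \<circ> Y)"
    by (rule indep_var_compose[OF indep]) auto
  then have "distr M borel X \<Otimes>\<^sub>M distr M borel (\<lambda>\<omega>. Y \<omega> / \<sigma>)
      = distr M (borel \<Otimes>\<^sub>M borel) (\<lambda>\<omega>. (X \<omega>, Y \<omega> / \<sigma>))"
    by (simp add: indep_var_distribution_eq o_def)
  moreover have "distr M borel (\<lambda>\<omega>. Y \<omega> / \<sigma>) = std_normal_distribution"
  proof -
    have "distributed M lborel (\<lambda>\<omega>. Y \<omega> / \<sigma>) std_normal_density"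
      using Y normal_standard_normal_convert[OF \<sigma>, of Y 0] by simp
    then have "distr M lborel (\<lambda>\<omega>. Y \<omega> / \<sigma>) = std_normal_distribution"
      by (rule distributed_distr_eq_density)
    moreover have "distr M lborel (\<lambda>\<omega>. Y \<omega> / \<sigma>) = distr M borel (\<lambda>\<omega>. Y \<omega> / \<sigma>)"
      by (rule distr_cong) auto
    ultimately show ?thesis by simp
  qed
  ultimately have "distr (distr M borel X \<Otimes>\<^sub>M std_normal_distribution) borel (\<lambda>(x, y). \<sigma> * x * y)
      = distr (distr M (borel \<Otimes>\<^sub>M borel) (\<lambda>\<omega>. (X \<omega>, Y \<omega> / \<sigma>))) borel (\<lambda>(x, y). \<sigma> * x * y)"
    by simp
  also have "\<dots> = distr M borel (\<lambda>\<omega>. X \<omega> * Y \<omega>)"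
    using \<sigma> by (subst distr_distr) (auto simp: o_def)
  finally show ?thesis by simp
qed


section \<open>Gamma integrals, the Bessel integral and its limit at zero\<close>

lemma nn_integral_Gamma_scaled:
  assumes a: "a > 0" and b: "b > (0 :: real)"
  shows "(\<integral>\<^sup>+v. ennreal (v powr (a - 1) * exp (- (b * v))) * indicator {0<..} v \<partial>lborel)
    = ennreal (Gamma a / b powr a)"
proof -
  have "ennreal (Gamma a) = (\<integral>\<^sup>+t. ennreal (indicator {0..} t * t powr (a - 1) / exp t) \<partial>lborel)"
    by (rule Gamma_conv_nn_integral_real[OF a])
  also have "\<dots> = b * (\<integral>\<^sup>+v. ennreal (indicator {0..} (0 + b * v) * (0 + b * v) powr (a - 1) / exp (0 + b * v)) \<partial>lborel)"
    using b by (subst nn_integral_real_affine[where c=b and t=0]) auto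
  also have "\<dots> = (\<integral>\<^sup>+v. ennreal b * ennreal (indicator {0..} (b * v) * (b * v) powr (a - 1) / exp (b * v)) \<partial>lborel)"
    by (subst nn_integral_cmult) auto
  also have "\<dots> = (\<integral>\<^sup>+v. ennreal (b powr a) * (ennreal (v powr (a - 1) * exp (- (b * v))) * indicator {0<..} v) \<partial>lborel)"
  \<comment> \<open>The indicators of \<open>{0..}\<close> and \<open>{0<..}\<close> differ only at
    0, a null set.\<close>
  proof (rule nn_integral_cong_AE, rule AE_I[where N="{0}"])
    show "{v \<in> space lborel. \<not> ennreal b * ennreal (indicator {0..} (b * v) * (b * v) powr (a - 1) / exp (b * v))
       = ennreal (b powr a) * (ennreal (v powr (a - 1) * exp (- (b * v))) * indicator {0<..} v)} \<subseteq> {0}"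
    proof (safe, rule ccontr)
      fix v :: real
      assume ne: "ennreal b * ennreal (indicator {0..} (b * v) * (b * v) powr (a - 1) / exp (b * v))
       \<noteq> ennreal (b powr a) * (ennreal (v powr (a - 1) * exp (- (b * v))) * indicator {0<..} v)" and "v \<noteq> 0"
      then consider "v > 0" | "v < 0" by linarith
      then show False
      proof cases
        case 1
        have "b * ((b * v) powr (a - 1) / exp (b * v)) = b powr a * (v powr (a - 1) * exp (- (b * v)))"
          using b 1 by (simp add: powr_mult powr_diff exp_minus field_simps)
        with 1 b ne show False by (simp add: ennreal_mult'[symmetric])
      next
        case 2
        then have "b * v < 0" using b by (simp add: mult_pos_neg)
        with 2 ne show False by simp
      qed
    qed
  qed auto
  also have "\<dots> = ennreal (b powr a) * (\<integral>\<^sup>+v. ennreal (v powr (a - 1) * exp (- (b * v))) * indicator {0<..} v \<partial>lborel)"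
    by (subst nn_integral_cmult) auto
  finally have *: "ennreal (Gamma a) = ennreal (b powr a) * (\<integral>\<^sup>+v. ennreal (v powr (a - 1) * exp (- (b * v))) * indicator {0<..} v \<partial>lborel)"
    (is "_ = _ * ?I") .
  have "ennreal (Gamma a / b powr a) = ennreal (1 / b powr a) * ennreal (Gamma a)"
    using b a by (simp add: ennreal_mult'[symmetric])
  also have "\<dots> = ?I"
    unfolding * using b by (simp add: mult.assoc[symmetric] ennreal_mult'[symmetric])
  finally show ?thesis ..
qed

text \<open>At \<open>c = 0\<close> this is the Gamma integral, infinite for \<open>\<nu> \<le> 0\<close>, so that working in \<^typ>\<open>ennreal\<close>
  covers the limit at \<open>x = 0\<close> in \<^const>\<open>powr_bessel_K\<close>.\<close>

definition bessel_nn_integral :: "real \<Rightarrow> real \<Rightarrow> ennreal" where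
  "bessel_nn_integral \<nu> c =
     (\<integral>\<^sup>+u. ennreal (u powr (\<nu> - 1) * exp (- u - c / u)) * indicator {0<..} u \<partial>lborel)"

lemma bessel_nn_integral_0:
  assumes "\<nu> > 0"
  shows "bessel_nn_integral \<nu> 0 = ennreal (Gamma \<nu>)"
  using nn_integral_Gamma_scaled[OF assms, of 1] by (simp add: bessel_nn_integral_def)

lemma bessel_nn_integral_antimono:
  assumes "c \<le> d"
  shows "bessel_nn_integral \<nu> d \<le> bessel_nn_integral \<nu> c"
  unfolding bessel_nn_integral_def using assms
  by (intro nn_integral_mono) (auto simp: indicator_def divide_right_mono intro!: ennreal_leI mult_left_mono)

text \<open>From \<open>sqrt y \<le> 1 + y \<le> exp y\<close> at \<open>y = c / u\<close> one gets
  \<open>exp (- (c / u)) \<le> sqrt (u / c)\<close>, which trades the singular factor for half a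
  power of \<open>u\<close>. With \<open>\<nu> = a + k - 1 / 2\<close> the bound is a multiple of
  \<open>Gamma (a + k)\<close>, exactly the factor dividing the \<open>k\<close>-th term of the
  series.\<close>

lemma bessel_nn_integral_le_Gamma:
  assumes c: "c > 0" and \<nu>: "\<nu> > - 1 / 2"
  shows "bessel_nn_integral \<nu> c \<le> ennreal (1 / sqrt c * Gamma (\<nu> + 1 / 2))"
proof -
  have "bessel_nn_integral \<nu> c
      \<le> (\<integral>\<^sup>+u. ennreal (1 / sqrt c) * (ennreal (u powr ((\<nu> + 1 / 2) - 1) * exp (- (1 * u))) * indicator {0<..} u) \<partial>lborel)"
    unfolding bessel_nn_integral_def
  proof (rule nn_integral_mono)
    fix u :: real
    show "ennreal (u powr (\<nu> - 1) * exp (- u - c / u)) * indicator {0<..} u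
      \<le> ennreal (1 / sqrt c) * (ennreal (u powr ((\<nu> + 1 / 2) - 1) * exp (- (1 * u))) * indicator {0<..} u)"
    proof (cases "u > 0")
      case True
      have "sqrt (c / u) \<le> 1 + c / u"
      proof (rule real_le_lsqrt)
        have "0 < c / u" using c True by simp
        moreover have "(1 + c / u)\<^sup>2 = 1 + 2 * (c / u) + (c / u)\<^sup>2"
          unfolding power2_sum by simp
        ultimately show "0 \<le> 1 + c / u" "c / u \<le> (1 + c / u)\<^sup>2"
          using zero_le_power2[of "c / u"] by linarith+
      qed
      also have "\<dots> \<le> exp (c / u)" by (rule exp_ge_add_one_self)
      finally have "exp (- (c / u)) \<le> 1 / sqrt (c / u)"
        using c True by (simp add: exp_minus field_simps)
      also have "\<dots> = 1 / sqrt c * u powr (1 / 2)"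
        using True c by (simp add: real_sqrt_divide powr_half_sqrt)
      finally have "u powr (\<nu> - 1) * exp (- u) * exp (- (c / u)) \<le> u powr (\<nu> - 1) * exp (- u) * (1 / sqrt c * u powr (1 / 2))"
        by (intro mult_left_mono) auto
      also have "\<dots> = 1 / sqrt c * (u powr ((\<nu> - 1) + 1 / 2) * exp (- u))"
        by (simp only: powr_add ac_simps)
      also have "\<nu> - 1 + 1 / 2 = (\<nu> + 1 / 2) - 1" by simp
      finally have le: "u powr (\<nu> - 1) * exp (- u) * exp (- (c / u))
          \<le> 1 / sqrt c * (u powr (\<nu> + 1 / 2 - 1) * exp (- u))" .
      have "exp (- u - c / u) = exp (- u) * exp (- (c / u))"
        by (simp add: exp_add[symmetric])
      then have "ennreal (u powr (\<nu> - 1) * exp (- u - c / u))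
          \<le> ennreal (1 / sqrt c * (u powr (\<nu> + 1 / 2 - 1) * exp (- u)))"
        using le by (intro ennreal_leI) (simp only: mult.assoc)
      also have "\<dots> = ennreal (1 / sqrt c) * ennreal (u powr (\<nu> + 1 / 2 - 1) * exp (- u))"
        using c by (intro ennreal_mult') simp
      finally show ?thesis using True by simp
    qed simp
  qed
  also have "\<dots> = ennreal (1 / sqrt c) * ennreal (Gamma (\<nu> + 1 / 2) / 1 powr (\<nu> + 1 / 2))"
    using \<nu> by (subst nn_integral_cmult, measurable, subst nn_integral_Gamma_scaled) auto
  finally show ?thesis using c \<nu> by (simp add: ennreal_mult'[symmetric])
qed

text \<open>\<open>Beta \<nu> (1 / 2) = Gamma \<nu> * sqrt pi / Gamma (\<nu> + 1 / 2)\<close>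
  decreases in \<open>\<nu>\<close> and equals \<open>pi\<close> at \<open>\<nu> = 1 / 2\<close>.
  This replaces the previous bound at \<open>c = 0\<close>, where the Bessel integral is
  \<open>Gamma \<nu>\<close>.\<close>

lemma Gamma_le_Gamma_add_half:
  assumes "\<nu> \<ge> 1 / 2"
  shows "Gamma \<nu> \<le> sqrt pi * Gamma (\<nu> + 1 / 2)"
proof -
  have "Beta \<nu> (1 / 2) \<le> Beta (1 / 2) (1 / 2 :: real)"
  proof (rule has_integral_le)
    show "((\<lambda>t. t powr (\<nu> - 1) * (1 - t) powr (1 / 2 - 1)) has_integral Beta \<nu> (1 / 2)) {0..1}"
      using assms by (intro has_integral_Beta_real) auto
    show "((\<lambda>t. t powr (1 / 2 - 1) * (1 - t) powr (1 / 2 - 1)) has_integral Beta (1 / 2) (1 / 2 :: real)) {0..1}"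
      by (intro has_integral_Beta_real) auto
  next
    fix t :: real assume "t \<in> {0..1}"
    then show "t powr (\<nu> - 1) * (1 - t) powr (1 / 2 - 1) \<le> t powr (1 / 2 - 1) * (1 - t) powr (1 / 2 - 1)"
      using assms by (intro mult_right_mono powr_mono') auto
  qed
  also have "Beta (1 / 2) (1 / 2 :: real) = pi"
    by (simp add: Beta_def Gamma_one_half_real)
  finally have "Gamma \<nu> * sqrt pi \<le> pi * Gamma (\<nu> + 1 / 2)"
    using assms by (simp add: Beta_def Gamma_one_half_real field_simps)
  then have "Gamma \<nu> \<le> pi / sqrt pi * Gamma (\<nu> + 1 / 2)"
    by (simp add: field_simps)
  also have "pi / sqrt pi = sqrt pi" by (rule real_div_sqrt) simp
  finally show ?thesis .
qed

text \<open>Change of variables \<open>u = c / t\<close>, a bijection of the positive half-line onto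
  itself whose derivative has absolute value \<open>c / t\<^sup>2\<close>.\<close>

lemma set_integral_inversion:
  fixes f :: "real \<Rightarrow> real"
  assumes c: "c > 0" and f: "set_integrable lborel {0<..} f"
    and [measurable]: "f \<in> borel_measurable borel"
  shows "(LINT t:{0<..}|lborel. c / t\<^sup>2 * f (c / t)) = (LINT u:{0<..}|lborel. f u)"
proof -
  have "(\<lambda>t. c / t) ` {0<..} = {0<..}"
  proof safe
    fix u :: real assume "u > 0"
    then show "u \<in> (\<lambda>t. c / t) ` {0<..}"
      using c by (intro image_eqI[where x="c / u"]) auto
  qed (use c in auto)
  moreover have "(\<lambda>t. \<bar>- c / t\<^sup>2\<bar> * f (c / t)) absolutely_integrable_on {0<..} \<and>
       integral {0<..} (\<lambda>t. \<bar>- c / t\<^sup>2\<bar> * f (c / t)) = b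
     \<longleftrightarrow> f absolutely_integrable_on ((\<lambda>t. c / t) ` {0<..}) \<and> integral ((\<lambda>t. c / t) ` {0<..}) f = b" for b
  proof (rule has_absolute_integral_change_of_variables_1'[where g="\<lambda>t. c / t" and g'="\<lambda>t. - c / t\<^sup>2" and S="{0<..}" and f=f])
    show "inj_on (\<lambda>t. c / t) {0<..}"
      using c by (auto simp: inj_on_def field_simps)
    show "((\<lambda>t. c / t) has_field_derivative - c / t\<^sup>2) (at t within {0<..})" if "t \<in> {0<..}" for t
      using that by (auto intro!: derivative_eq_intros simp: power2_eq_square)
  qed auto
  \<comment> \<open>Absolute integrability refers to the completion of \<open>lborel\<close>; for
    Borel functions integrability passes in both directions.\<close>
  moreover have "f absolutely_integrable_on {0<..}"
    using f unfolding set_integrable_def by (intro integrable_completion[THEN iffD2]) auto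
  ultimately have 1: "(\<lambda>t. \<bar>- c / t\<^sup>2\<bar> * f (c / t)) absolutely_integrable_on {0<..}"
    and 2: "integral {0<..} (\<lambda>t. \<bar>- c / t\<^sup>2\<bar> * f (c / t)) = integral {0<..} f"
    by auto
  have eq: "(\<lambda>t. \<bar>- c / t\<^sup>2\<bar> * f (c / t)) = (\<lambda>t. c / t\<^sup>2 * f (c / t))"
    using c by auto
  have "set_integrable lborel {0<..} (\<lambda>t. c / t\<^sup>2 * f (c / t))"
    using 1 unfolding eq set_integrable_def by (subst (asm) integrable_completion) auto
  then have "(LINT t:{0<..}|lborel. c / t\<^sup>2 * f (c / t)) = integral {0<..} (\<lambda>t. c / t\<^sup>2 * f (c / t))"
    by (rule set_borel_integral_eq_integral)
  also have "\<dots> = integral {0<..} f" using 2 unfolding eq .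
  also have "\<dots> = (LINT u:{0<..}|lborel. f u)"
    using set_borel_integral_eq_integral(2)[OF f] by simp
  finally show ?thesis .
qed

text \<open>With \<open>c = (\<bar>x\<bar> / s)\<^sup>2 / 4\<close> the integrand of
  \<open>bessel_K\<close> has exponent \<open>- t - c / t\<close>, which the inversion
  \<open>t = c / u\<close> preserves while the power of \<open>t\<close> becomes
  \<open>u powr (\<nu> - 1)\<close>. On the right \<open>x\<close> survives only inside the
  integral, so that side also makes sense at \<open>x = 0\<close>.\<close>

lemma bessel_K_eq_nn_integral:
  assumes s: "s > 0" and x: "x \<noteq> 0" and \<nu>: "\<nu> \<ge> 0"
  shows "ennreal (\<bar>x\<bar> powr \<nu> * bessel_K \<nu> (\<bar>x\<bar> / s))
    = ennreal (1 / 2 * (2 * s) powr \<nu>) * bessel_nn_integral \<nu> (x\<^sup>2 / (4 * s\<^sup>2))"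
proof -
  define c where "c = x\<^sup>2 / (4 * s\<^sup>2)"
  define f where "f u = u powr (\<nu> - 1) * exp (- u - c / u)" for u :: real
  have c: "c > 0" using s x by (simp add: c_def)
  have [measurable]: "f \<in> borel_measurable borel" unfolding f_def by measurable
  have fnn: "f u \<ge> 0" for u by (simp add: f_def)
  have J: "bessel_nn_integral \<nu> c = (\<integral>\<^sup>+u. ennreal (indicator {0<..} u *\<^sub>R f u) \<partial>lborel)"
    unfolding bessel_nn_integral_def f_def by (intro nn_integral_cong) (auto simp: indicator_def)
  \<comment> \<open>Finiteness is what identifies the real-valued integral in
    \<open>bessel_K\<close> with the extended nonnegative one.\<close>
  have "bessel_nn_integral \<nu> c \<le> ennreal (1 / sqrt c * Gamma (\<nu> + 1 / 2))"
    using \<nu> by (intro bessel_nn_integral_le_Gamma c) auto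
  then have fin: "bessel_nn_integral \<nu> c < \<infinity>"
    by (rule le_less_trans) simp
  have int: "set_integrable lborel {0<..} f"
    unfolding set_integrable_def
    by (rule integrableI_nonneg) (use fin fnn in \<open>auto simp: J\<close>)
  have LJ: "ennreal (LINT u:{0<..}|lborel. f u) = bessel_nn_integral \<nu> c"
    unfolding set_lebesgue_integral_def J
    using int fnn by (subst nn_integral_eq_integral) (auto simp: set_integrable_def)
  have "(LINT t:{0<..}|lborel. exp (- t - (\<bar>x\<bar> / s)\<^sup>2 / (4 * t)) / t powr (\<nu> + 1))
      = (LINT t:{0<..}|lborel. c powr (- \<nu>) * (c / t\<^sup>2 * f (c / t)))"
  proof (rule set_lebesgue_integral_cong)
    show "\<forall>t. t \<in> {0<..} \<longrightarrow> exp (- t - (\<bar>x\<bar> / s)\<^sup>2 / (4 * t)) / t powr (\<nu> + 1)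
        = c powr (- \<nu>) * (c / t\<^sup>2 * f (c / t))"
    proof safe
      fix t :: real assume t: "t > 0"
      have e: "(\<bar>x\<bar> / s)\<^sup>2 / (4 * t) = c / t" by (simp add: c_def power_divide)
      have t2: "t\<^sup>2 = t powr 2" using t by simp
      have "c / t\<^sup>2 * (c / t) powr (\<nu> - 1) = c powr \<nu> / (t powr (\<nu> - 1) * t powr 2)"
        using c t by (simp add: powr_divide powr_diff)
      also have "t powr (\<nu> - 1) * t powr 2 = t powr (\<nu> + 1)"
        by (simp add: powr_add[symmetric] add.commute)
      finally have "c powr (- \<nu>) * (c / t\<^sup>2 * f (c / t))
          = c powr (- \<nu>) * c powr \<nu> / t powr (\<nu> + 1) * exp (- (c / t) - c / (c / t))"
        unfolding f_def by (simp add: mult.assoc[symmetric])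
      also have "c / (c / t) = t" using c by simp
      also have "c powr (- \<nu>) * c powr \<nu> = 1" using c by (simp add: powr_add[symmetric])
      finally show "exp (- t - (\<bar>x\<bar> / s)\<^sup>2 / (4 * t)) / t powr (\<nu> + 1)
        = c powr (- \<nu>) * (c / t\<^sup>2 * f (c / t))"
        unfolding e by (simp add: algebra_simps)
    qed
  qed simp
  also have "\<dots> = c powr (- \<nu>) * (LINT u:{0<..}|lborel. f u)"
    by (subst set_integral_mult_right, subst set_integral_inversion[OF c int]) auto
  finally have K: "\<bar>x\<bar> powr \<nu> * bessel_K \<nu> (\<bar>x\<bar> / s)
      = \<bar>x\<bar> powr \<nu> * (1 / 2 * (\<bar>x\<bar> / s / 2) powr \<nu> * (c powr (- \<nu>) * (LINT u:{0<..}|lborel. f u)))"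
    by (simp add: bessel_K_def)
  \<comment> \<open>The powers of \<open>\<bar>x\<bar>\<close> outside the integral cancel against
    \<open>c powr (- \<nu>)\<close>, leaving \<open>(2 * s) powr \<nu>\<close>.\<close>
  have "\<bar>x\<bar> powr \<nu> * (\<bar>x\<bar> / s / 2) powr \<nu> * c powr (- \<nu>) = (\<bar>x\<bar> * (\<bar>x\<bar> / s / 2) / c) powr \<nu>"
  proof -
    have "p powr \<nu> * q powr \<nu> * c powr (- \<nu>) = (p * q / c) powr \<nu>" if "p \<ge> 0" "q \<ge> 0" for p q
      using that c by (simp add: powr_mult powr_divide powr_minus_divide)
    then show ?thesis using s by simp
  qed
  also have "\<bar>x\<bar> * (\<bar>x\<bar> / s / 2) / c = 2 * s"
    using s x by (simp add: c_def power2_eq_square abs_mult_self_eq)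
  finally have "\<bar>x\<bar> powr \<nu> * bessel_K \<nu> (\<bar>x\<bar> / s) = (1 / 2 * (2 * s) powr \<nu>) * (LINT u:{0<..}|lborel. f u)"
    unfolding K by (simp add: algebra_simps)
  then show ?thesis
    unfolding c_def[symmetric] LJ[symmetric] by (simp only:) (rule ennreal_mult', simp)
qed

text \<open>Fatou bounds the lower limit from below, and antitonicity in \<open>c\<close> bounds
  every term by the value at 0. The argument also covers an infinite limit, as for
  \<open>\<nu> = 0\<close>, where dominated convergence fails.\<close>

lemma tendsto_bessel_nn_integral_0:
  assumes d: "d > 0"
  shows "((\<lambda>x. bessel_nn_integral \<nu> (x\<^sup>2 / d)) \<longlongrightarrow> bessel_nn_integral \<nu> 0) (at 0)"
  unfolding tendsto_at_iff_sequentially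
proof (intro allI impI)
  fix X :: "nat \<Rightarrow> real" assume X: "X \<longlonglongrightarrow> 0"
  let ?f = "\<lambda>i u. ennreal (u powr (\<nu> - 1) * exp (- u - ((X i)\<^sup>2 / d) / u)) * indicator {0<..} u"
  have "(\<lambda>i. ?f i u) \<longlonglongrightarrow> ennreal (u powr (\<nu> - 1) * exp (- u - (0\<^sup>2 / d) / u)) * indicator {0<..} u" for u
  proof (cases "u > 0")
    case True
    have "(\<lambda>i. u powr (\<nu> - 1) * exp (- u - ((X i)\<^sup>2 / d) / u))
        \<longlonglongrightarrow> u powr (\<nu> - 1) * exp (- u - (0\<^sup>2 / d) / u)"
      using X d True by (intro tendsto_intros) auto
    with True show ?thesis by (auto intro: tendsto_ennrealI)
  qed simp
  then have "liminf (\<lambda>i. ?f i u) = ennreal (u powr (\<nu> - 1) * exp (- u - 0 / u)) * indicator {0<..} u" for u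
    by (intro lim_imp_Liminf) auto
  then have "bessel_nn_integral \<nu> 0 = (\<integral>\<^sup>+u. liminf (\<lambda>i. ?f i u) \<partial>lborel)"
    by (simp add: bessel_nn_integral_def)
  also have "\<dots> \<le> liminf (\<lambda>i. bessel_nn_integral \<nu> ((X i)\<^sup>2 / d))"
    unfolding bessel_nn_integral_def by (rule nn_integral_liminf) measurable
  finally have lower: "bessel_nn_integral \<nu> 0 \<le> liminf (\<lambda>i. bessel_nn_integral \<nu> ((X i)\<^sup>2 / d))" .
  have upper: "bessel_nn_integral \<nu> ((X i)\<^sup>2 / d) \<le> bessel_nn_integral \<nu> 0" for i
    using d by (intro bessel_nn_integral_antimono) auto
  show "((\<lambda>x. bessel_nn_integral \<nu> (x\<^sup>2 / d)) \<circ> X) \<longlonglongrightarrow> bessel_nn_integral \<nu> 0"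
    unfolding o_def
  proof (rule order_tendstoI)
    fix a assume "a < bessel_nn_integral \<nu> 0"
    then have "a < liminf (\<lambda>i. bessel_nn_integral \<nu> ((X i)\<^sup>2 / d))" using lower by (rule less_le_trans)
    then show "eventually (\<lambda>i. a < bessel_nn_integral \<nu> ((X i)\<^sup>2 / d)) sequentially"
      by (rule less_LiminfD)
  next
    fix a assume "a > bessel_nn_integral \<nu> 0"
    then show "eventually (\<lambda>i. bessel_nn_integral \<nu> ((X i)\<^sup>2 / d) < a) sequentially"
      using upper le_less_trans by (intro always_eventually) blast
  qed
qed

text \<open>Both sides agree on a punctured neighbourhood of 0, so the \<open>Lim\<close> in the
  definition is the limit of the integral form.\<close>

lemma powr_bessel_K_eq_nn_integral:
  assumes s: "s > 0" and \<nu>: "\<nu> \<ge> 0"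
  shows "powr_bessel_K \<nu> s x
    = ennreal (1 / 2 * (2 * s) powr \<nu>) * bessel_nn_integral \<nu> (x\<^sup>2 / (4 * s\<^sup>2))"
proof (cases "x = 0")
  case True
  have "((\<lambda>y. ennreal (1 / 2 * (2 * s) powr \<nu>) * bessel_nn_integral \<nu> (y\<^sup>2 / (4 * s\<^sup>2)))
      \<longlongrightarrow> ennreal (1 / 2 * (2 * s) powr \<nu>) * bessel_nn_integral \<nu> 0) (at 0)"
    using s by (intro ennreal_tendsto_cmult tendsto_bessel_nn_integral_0) auto
  moreover have "eventually (\<lambda>y. ennreal (1 / 2 * (2 * s) powr \<nu>) * bessel_nn_integral \<nu> (y\<^sup>2 / (4 * s\<^sup>2))
      = ennreal (\<bar>y\<bar> powr \<nu> * bessel_K \<nu> (\<bar>y\<bar> / s))) (at 0)"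
    using bessel_K_eq_nn_integral[OF s _ \<nu>] by (auto simp: eventually_at_filter)
  ultimately have "((\<lambda>y. ennreal (\<bar>y\<bar> powr \<nu> * bessel_K \<nu> (\<bar>y\<bar> / s)))
      \<longlongrightarrow> ennreal (1 / 2 * (2 * s) powr \<nu>) * bessel_nn_integral \<nu> 0) (at 0)"
    by (rule Lim_transform_eventually)
  then show ?thesis
    using True by (simp add: powr_bessel_K_def tendsto_Lim)
qed (simp add: powr_bessel_K_def bessel_K_eq_nn_integral[OF s _ \<nu>])


section \<open>The Poisson mixture of Gamma laws and its normal scale mixture\<close>

text \<open>For \<open>a = n / 2\<close> this is the density of half a noncentral chi-squared
  variable with \<open>n\<close> degrees of freedom and noncentrality \<open>2 * l\<close>. With the
  \<open>l\<close> of the theorem it is the law of the sum of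
  \<open>X_i\<^sup>2 / (2 * \<sigma>X\<^sup>2)\<close> over \<open>n\<close> independent copies of
  \<open>X\<close>, so \<open>s * sqrt (2 * v)\<close> is the standard deviation of the sum of
  products given these copies.\<close>

definition poisson_gamma_density :: "real \<Rightarrow> real \<Rightarrow> real \<Rightarrow> ennreal" where
  "poisson_gamma_density a l v =
     (\<Sum>k. ennreal (exp (- l) * l ^ k / (fact k * Gamma (a + real k)))
       * (ennreal (v powr (a + real k - 1) * exp (- v)) * indicator {0<..} v))"

lemma borel_measurable_poisson_gamma_density [measurable]:
  "poisson_gamma_density a l \<in> borel_measurable borel"
  unfolding poisson_gamma_density_def by measurable

lemma poisson_gamma_density_nonpos: "v \<le> 0 \<Longrightarrow> poisson_gamma_density a l v = 0"
  by (simp add: poisson_gamma_density_def)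

lemma nn_integral_poisson_gamma_density:
  assumes [measurable]: "F \<in> borel_measurable borel"
  shows "(\<integral>\<^sup>+v. poisson_gamma_density a l v * F v \<partial>lborel)
    = (\<Sum>k. ennreal (exp (- l) * l ^ k / (fact k * Gamma (a + real k)))
       * (\<integral>\<^sup>+v. ennreal (v powr (a + real k - 1) * exp (- v)) * indicator {0<..} v * F v \<partial>lborel))"
  unfolding poisson_gamma_density_def
  by (simp add: ennreal_suminf_multc[symmetric] mult.assoc nn_integral_suminf nn_integral_cmult
      del: ennreal_suminf_multc)

text \<open>The Gamma factors cancel and the exponential series of \<open>l / D\<close> remains.
  Used with \<open>D = 1 + r\<close> for the Laplace transform and with \<open>D = 1\<close> as a
  majorant for the Bessel series.\<close>

lemma suminf_poisson_Gamma:
  fixes l D :: real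
  assumes a: "a > 0" and l: "l \<ge> 0" and D: "D > 0"
  shows "(\<Sum>k. ennreal (exp (- l) * l ^ k / (fact k * Gamma (a + real k)))
      * ennreal (Gamma (a + real k) / D powr (a + real k)))
    = ennreal (exp (l / D - l) / D powr a)"
proof -
  have "ennreal (exp (- l) * l ^ k / (fact k * Gamma (a + real k))) * ennreal (Gamma (a + real k) / D powr (a + real k))
      = ennreal (exp (- l) / D powr a * ((l / D) ^ k /\<^sub>R fact k))" for k
  proof -
    have "Gamma (a + real k) > 0" using a by (intro Gamma_real_pos) auto
    then show ?thesis using l D
      by (simp add: ennreal_mult'[symmetric] powr_add powr_realpow power_divide field_simps)
  qed
  moreover have "(\<Sum>k. ennreal (exp (- l) / D powr a * ((l / D) ^ k /\<^sub>R fact k)))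
      = ennreal (exp (- l) / D powr a * exp (l / D))"
    using l D by (intro suminf_ennreal_eq sums_mult exp_converges) auto
  ultimately show ?thesis by (simp add: exp_diff exp_minus field_simps)
qed

text \<open>The factor \<open>exp (- (r * v))\<close> changes the rate of every Gamma component from
  1 to \<open>1 + r\<close>. At \<open>r = 0\<close> this gives total mass 1.\<close>

lemma laplace_poisson_gamma_density:
  assumes a: "a > 0" and l: "l \<ge> 0" and r: "r \<ge> 0"
  shows "(\<integral>\<^sup>+v. poisson_gamma_density a l v * ennreal (exp (- (r * v))) \<partial>lborel)
    = ennreal (exp (l / (1 + r) - l) / (1 + r) powr a)"
proof -
  have "(\<integral>\<^sup>+v. ennreal (v powr (a + real k - 1) * exp (- v)) * indicator {0<..} v * ennreal (exp (- (r * v))) \<partial>lborel)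
      = ennreal (Gamma (a + real k) / (1 + r) powr (a + real k))" for k
  proof -
    have "(\<integral>\<^sup>+v. ennreal (v powr (a + real k - 1) * exp (- v)) * indicator {0<..} v * ennreal (exp (- (r * v))) \<partial>lborel)
      = (\<integral>\<^sup>+v. ennreal (v powr (a + real k - 1) * exp (- ((1 + r) * v))) * indicator {0<..} v \<partial>lborel)"
      by (intro nn_integral_cong)
        (auto simp: indicator_def ennreal_mult'[symmetric] mult.assoc exp_add[symmetric] algebra_simps)
    also have "\<dots> = ennreal (Gamma (a + real k) / (1 + r) powr (a + real k))"
      using a r by (intro nn_integral_Gamma_scaled) auto
    finally show ?thesis .
  qed
  then show ?thesis
    using suminf_poisson_Gamma[OF a l, of "1 + r"] r by (simp add: nn_integral_poisson_gamma_density)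
qed

lemma prob_space_poisson_gamma_density:
  assumes "a > 0" "l \<ge> 0"
  shows "prob_space (density lborel (poisson_gamma_density a l))"
  using laplace_poisson_gamma_density[OF assms, of 0]
  by (intro prob_spaceI) (simp add: emeasure_density)

text \<open>The factor 2 under the root makes \<open>(t * (s * sqrt (2 * v)))\<^sup>2 / 2\<close>
  equal to \<open>s\<^sup>2 * t\<^sup>2 * v\<close> for \<open>v \<ge> 0\<close>, so the Laplace
  transform is taken at \<open>r = s\<^sup>2 * t\<^sup>2\<close>.\<close>

lemma char_poisson_gamma_mixture:
  assumes a: "a > 0" and l: "l \<ge> 0"
  shows "char (distr (density lborel (poisson_gamma_density a l) \<Otimes>\<^sub>M std_normal_distribution) borel
      (\<lambda>(v, y). s * sqrt (2 * v) * y)) t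
    = of_real (exp (l / (1 + s\<^sup>2 * t\<^sup>2) - l) / (1 + s\<^sup>2 * t\<^sup>2) powr a)"
proof -
  let ?G = "density lborel (poisson_gamma_density a l)"
  have "(\<integral>\<^sup>+v. ennreal (exp (- (t * (s * sqrt (2 * v)))\<^sup>2 / 2)) \<partial>?G)
      = (\<integral>\<^sup>+v. poisson_gamma_density a l v * ennreal (exp (- (s\<^sup>2 * t\<^sup>2 * v))) \<partial>lborel)"
  proof (subst nn_integral_density, measurable, rule nn_integral_cong)
    fix v :: real
    show "poisson_gamma_density a l v * ennreal (exp (- (t * (s * sqrt (2 * v)))\<^sup>2 / 2))
        = poisson_gamma_density a l v * ennreal (exp (- (s\<^sup>2 * t\<^sup>2 * v)))"
      \<comment> \<open>\<open>sqrt\<close> is odd, so the exponents may differ for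
        \<open>v < 0\<close>; both sides vanish there.\<close>
      by (cases "v \<le> 0") (auto simp: poisson_gamma_density_nonpos power_mult_distrib ac_simps)
  qed
  also have "\<dots> = ennreal (exp (l / (1 + s\<^sup>2 * t\<^sup>2) - l) / (1 + s\<^sup>2 * t\<^sup>2) powr a)"
    using a l by (intro laplace_poisson_gamma_density) auto
  finally have "(LINT v|?G. exp (- (t * (s * sqrt (2 * v)))\<^sup>2 / 2))
      = exp (l / (1 + s\<^sup>2 * t\<^sup>2) - l) / (1 + s\<^sup>2 * t\<^sup>2) powr a"
    by (subst integral_eq_nn_integral) auto
  then show ?thesis
    using prob_space_poisson_gamma_density[OF a l]
    by (subst char_normal_scale_mixture) auto
qed

text \<open>At variance \<open>2 * s\<^sup>2 * v\<close> the normal density contributes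
  \<open>v powr (- 1 / 2)\<close> and \<open>exp (- x\<^sup>2 / (4 * s\<^sup>2 * v))\<close>. A
  Gamma integrand of shape \<open>b\<close> thus becomes a Bessel integrand of order
  \<open>b - 1 / 2\<close>.\<close>

lemma poisson_gamma_mixture_density:
  assumes s: "s > 0"
  shows "(\<integral>\<^sup>+v. poisson_gamma_density a l v * ennreal (normal_density 0 (s * sqrt (2 * v)) x) \<partial>lborel)
    = (\<Sum>k. ennreal (exp (- l) * l ^ k / (fact k * Gamma (a + real k)))
        * (ennreal (1 / (2 * s * sqrt pi)) * bessel_nn_integral (a + real k - 1 / 2) (x\<^sup>2 / (4 * s\<^sup>2))))"
proof -
  let ?nd = "\<lambda>v. ennreal (normal_density 0 (s * sqrt (2 * v)) x)"
  have meas: "?nd \<in> borel_measurable borel" unfolding normal_density_def by measurable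
  have "(\<integral>\<^sup>+v. ennreal (v powr (b - 1) * exp (- v)) * indicator {0<..} v * ?nd v \<partial>lborel)
      = ennreal (1 / (2 * s * sqrt pi)) * bessel_nn_integral (b - 1 / 2) (x\<^sup>2 / (4 * s\<^sup>2))" for b
  proof -
    have "(\<integral>\<^sup>+v. ennreal (v powr (b - 1) * exp (- v)) * indicator {0<..} v * ?nd v \<partial>lborel)
      = (\<integral>\<^sup>+v. ennreal (1 / (2 * s * sqrt pi)) * (ennreal (v powr (b - 1 / 2 - 1) * exp (- v - x\<^sup>2 / (4 * s\<^sup>2) / v))
          * indicator {0<..} v) \<partial>lborel)"
    proof (rule nn_integral_cong)
      fix v :: real
      show "ennreal (v powr (b - 1) * exp (- v)) * indicator {0<..} v * ?nd v
        = ennreal (1 / (2 * s * sqrt pi)) * (ennreal (v powr (b - 1 / 2 - 1) * exp (- v - x\<^sup>2 / (4 * s\<^sup>2) / v))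
          * indicator {0<..} v)"
      proof (cases "v > 0")
        case True
        have "sqrt (2 * pi * (s * sqrt (2 * v))\<^sup>2) = sqrt ((2 * s)\<^sup>2 * (pi * v))"
          using True by (simp add: power_mult_distrib algebra_simps)
        also have "\<dots> = 2 * s * sqrt pi * v powr (1 / 2)"
          using True s by (simp add: real_sqrt_mult powr_half_sqrt)
        finally have 1: "sqrt (2 * pi * (s * sqrt (2 * v))\<^sup>2) = 2 * s * sqrt pi * v powr (1 / 2)" .
        have 2: "- (x - 0)\<^sup>2 / (2 * (s * sqrt (2 * v))\<^sup>2) = - (x\<^sup>2 / (4 * s\<^sup>2) / v)"
          using True by (simp add: power_mult_distrib)
        have "b - 1 / 2 - 1 = (b - 1) - 1 / 2" by simp
        then have 3: "v powr (b - 1 / 2 - 1) = v powr (b - 1) / v powr (1 / 2)"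
          by (simp only: powr_diff)
        have "v powr (b - 1) * exp (- v) * normal_density 0 (s * sqrt (2 * v)) x
            = 1 / (2 * s * sqrt pi) * (v powr (b - 1 / 2 - 1) * exp (- v - x\<^sup>2 / (4 * s\<^sup>2) / v))"
          unfolding normal_density_def 1 2 3 by (simp add: exp_diff exp_minus field_simps)
        with True s show ?thesis by (simp add: ennreal_mult'[symmetric])
      qed simp
    qed
    also have "\<dots> = ennreal (1 / (2 * s * sqrt pi)) * bessel_nn_integral (b - 1 / 2) (x\<^sup>2 / (4 * s\<^sup>2))"
      unfolding bessel_nn_integral_def by (subst nn_integral_cmult) auto
    finally show ?thesis .
  qed
  then show ?thesis by (simp add: nn_integral_poisson_gamma_density[OF meas])
qed

text \<open>A bound of the Bessel integrals by \<open>B * Gamma (a + k)\<close> with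
  \<open>B\<close> independent of \<open>k\<close> leaves an exponential series. The excluded case
  is real: for \<open>a = 1 / 2\<close> and \<open>x = 0\<close> the term \<open>k = 0\<close> has
  order 0 and diverges.\<close>

lemma poisson_gamma_bessel_series_finite:
  assumes s: "s > 0" and a: "a > 0" and l: "l \<ge> 0" and x: "x \<noteq> 0 \<or> a \<ge> 1"
  shows "(\<Sum>k. ennreal (exp (- l) * l ^ k / (fact k * Gamma (a + real k)))
        * (ennreal (1 / (2 * s * sqrt pi)) * bessel_nn_integral (a + real k - 1 / 2) (x\<^sup>2 / (4 * s\<^sup>2)))) < \<infinity>"
proof -
  define c where "c = x\<^sup>2 / (4 * s\<^sup>2)"
  \<comment> \<open>\<open>B\<close> is \<open>1 / sqrt c\<close> for \<open>x \<noteq> 0\<close>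
    and \<open>sqrt pi\<close> for \<open>x = 0\<close>; in the latter case \<open>a \<ge> 1\<close>
    puts every order at or above \<open>1 / 2\<close>.\<close>
  obtain B where B: "\<And>k. bessel_nn_integral (a + real k - 1 / 2) c \<le> ennreal (B * Gamma (a + real k))" "B \<ge> 0"
  proof (cases "x = 0")
    case False
    then have c: "c > 0" using s by (simp add: c_def)
    show ?thesis
    proof (rule that)
      show "bessel_nn_integral (a + real k - 1 / 2) c \<le> ennreal (1 / sqrt c * Gamma (a + real k))" for k
        using bessel_nn_integral_le_Gamma[OF c, of "a + real k - 1 / 2"] a by simp
    qed (use c in simp)
  next
    case True
    then have c: "c = 0" and "a \<ge> 1" using x by (auto simp: c_def)
    show ?thesis
    proof (rule that)
      show "bessel_nn_integral (a + real k - 1 / 2) c \<le> ennreal (sqrt pi * Gamma (a + real k))" for k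
        using \<open>a \<ge> 1\<close> Gamma_le_Gamma_add_half[of "a + real k - 1 / 2"]
        unfolding c by (subst bessel_nn_integral_0) (auto intro!: ennreal_leI)
    qed simp
  qed
  define q where "q = 1 / (2 * s * sqrt pi)"
  have q: "q \<ge> 0" using s by (simp add: q_def)
  have "(\<Sum>k. ennreal (exp (- l) * l ^ k / (fact k * Gamma (a + real k)))
        * (ennreal q * bessel_nn_integral (a + real k - 1 / 2) c))
      \<le> (\<Sum>k. ennreal (q * B) * (ennreal (exp (- l) * l ^ k / (fact k * Gamma (a + real k)))
        * ennreal (Gamma (a + real k) / 1 powr (a + real k))))"
  proof (rule suminf_le)
    fix k
    have "ennreal q * bessel_nn_integral (a + real k - 1 / 2) c \<le> ennreal q * ennreal (B * Gamma (a + real k))"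
      by (intro mult_left_mono B) auto
    also have "\<dots> = ennreal (q * B) * ennreal (Gamma (a + real k) / 1 powr (a + real k))"
      using q B(2) by (simp add: ennreal_mult'[symmetric] mult.assoc)
    finally have "ennreal (exp (- l) * l ^ k / (fact k * Gamma (a + real k)))
        * (ennreal q * bessel_nn_integral (a + real k - 1 / 2) c)
      \<le> ennreal (exp (- l) * l ^ k / (fact k * Gamma (a + real k)))
        * (ennreal (q * B) * ennreal (Gamma (a + real k) / 1 powr (a + real k)))"
      by (intro mult_left_mono) auto
    then show "ennreal (exp (- l) * l ^ k / (fact k * Gamma (a + real k)))
        * (ennreal q * bessel_nn_integral (a + real k - 1 / 2) c)
      \<le> ennreal (q * B) * (ennreal (exp (- l) * l ^ k / (fact k * Gamma (a + real k)))
        * ennreal (Gamma (a + real k) / 1 powr (a + real k)))"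
      by (simp only: mult.left_commute)
  qed auto
  also have "\<dots> = ennreal (q * B) * ennreal (exp (l / 1 - l) / 1 powr a)"
    by (subst ennreal_suminf_cmult, subst suminf_poisson_Gamma) (use a l in auto)
  also have "\<dots> < \<infinity>" by (simp add: ennreal_mult_less_top)
  finally show ?thesis unfolding c_def q_def .
qed

section \<open>Matching the stated series with the mixture density\<close>

lemma sum_product_normal_density_eq_bessel_series:
  assumes X: "\<sigma>X > 0" and Y: "\<sigma>Y > 0" and n: "n \<ge> 1"
  shows "sum_product_normal_density n \<mu>X \<sigma>X \<sigma>Y x
    = (\<Sum>k. ennreal (exp (- (real n * \<mu>X\<^sup>2 / (2 * \<sigma>X\<^sup>2))) * (real n * \<mu>X\<^sup>2 / (2 * \<sigma>X\<^sup>2)) ^ k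
          / (fact k * Gamma (real n / 2 + real k)))
        * (ennreal (1 / (2 * (\<sigma>X * \<sigma>Y) * sqrt pi))
          * bessel_nn_integral (real n / 2 + real k - 1 / 2) (x\<^sup>2 / (4 * (\<sigma>X * \<sigma>Y)\<^sup>2))))"
proof -
  define s where "s = \<sigma>X * \<sigma>Y"
  define l where "l = real n * \<mu>X\<^sup>2 / (2 * \<sigma>X\<^sup>2)"
  define C where "C = 2 powr ((1 - real n) / 2) / (s powr ((real n + 1) / 2) * sqrt pi) * exp (- l)"
  define d where "d k = (real n * \<mu>X\<^sup>2 / 4) ^ k
    / (fact k * Gamma (real n / 2 + real k) * \<sigma>X ^ (3 * k) * \<sigma>Y ^ k)" for k
  define K where "K k = 1 / 2 * (2 * s) powr ((real n - 1) / 2 + real k)" for k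
  have s: "s > 0" using X Y by (simp add: s_def)
  have G: "Gamma (real n / 2 + real k) > 0" for k using n by (intro Gamma_real_pos) auto
  have nonneg: "C \<ge> 0" "d k \<ge> 0" "K k \<ge> 0" for k
    using s X Y G[of k] by (auto simp: C_def d_def K_def)
  have coeff: "C * d k * K k = exp (- l) * l ^ k / (fact k * Gamma (real n / 2 + real k)) * (1 / (2 * s * sqrt pi))" for k
  proof -
    \<comment> \<open>This is where \<open>\<sigma>X ^ (3 * k) * \<sigma>Y ^ k\<close> comes from:
      one factor \<open>2 * s\<close> per index, supplied by the Bessel term, turns the stated
      coefficients into powers of the Poisson parameter.\<close>
    have "2 * s * (real n * \<mu>X\<^sup>2 / 4) / (\<sigma>X ^ 3 * \<sigma>Y) = l"
      using X Y by (simp add: s_def l_def power2_eq_square power3_eq_cube field_simps)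
    then have 1: "(2 * s) ^ k * (real n * \<mu>X\<^sup>2 / 4) ^ k / (\<sigma>X ^ (3 * k) * \<sigma>Y ^ k) = l ^ k"
      by (simp only: power_mult power_mult_distrib[symmetric] power_divide[symmetric])
    \<comment> \<open>The part of the exponent free of \<open>k\<close> cancels the prefactor up to
      \<open>1 / s\<close>; the part \<open>k\<close> is absorbed into \<open>l ^ k\<close>.\<close>
    have "(2 * s) powr ((real n - 1) / 2 + real k)
        = (2 powr ((real n - 1) / 2) * s powr ((real n - 1) / 2)) * (2 * s) ^ k"
      using s by (simp add: powr_add powr_mult powr_realpow)
    then have "C * d k * K k = (2 powr ((1 - real n) / 2) * 2 powr ((real n - 1) / 2))
        * (s powr ((real n - 1) / 2) / s powr ((real n + 1) / 2))
        * ((2 * s) ^ k * (real n * \<mu>X\<^sup>2 / 4) ^ k / (\<sigma>X ^ (3 * k) * \<sigma>Y ^ k))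
        * (exp (- l) / (fact k * Gamma (real n / 2 + real k)) * (1 / (2 * sqrt pi)))"
      unfolding C_def d_def K_def by (simp add: ac_simps)
    also have "2 powr ((1 - real n) / 2) * 2 powr ((real n - 1) / 2) = (1 :: real)"
      by (simp add: powr_add[symmetric] add_divide_distrib[symmetric])
    also have "s powr ((real n - 1) / 2) / s powr ((real n + 1) / 2) = 1 / s"
    proof -
      have "(real n - 1) / 2 - (real n + 1) / 2 = - 1" by (simp add: field_simps)
      then have "s powr ((real n - 1) / 2) / s powr ((real n + 1) / 2) = s powr (- 1)"
        by (simp only: powr_diff[symmetric])
      then show ?thesis using s by (simp add: powr_minus_divide)
    qed
    finally show ?thesis unfolding 1 by (simp add: ac_simps)
  qed
  have term_eq: "ennreal C * (ennreal (d k) * powr_bessel_K ((real n - 1) / 2 + real k) s x)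
      = ennreal (exp (- l) * l ^ k / (fact k * Gamma (real n / 2 + real k)))
        * (ennreal (1 / (2 * s * sqrt pi)) * bessel_nn_integral (real n / 2 + real k - 1 / 2) (x\<^sup>2 / (4 * s\<^sup>2)))" for k
  proof -
    have "powr_bessel_K ((real n - 1) / 2 + real k) s x
        = ennreal (K k) * bessel_nn_integral ((real n - 1) / 2 + real k) (x\<^sup>2 / (4 * s\<^sup>2))"
      unfolding K_def using s n by (intro powr_bessel_K_eq_nn_integral) auto
    then have "ennreal C * (ennreal (d k) * powr_bessel_K ((real n - 1) / 2 + real k) s x)
        = ennreal (C * d k * K k) * bessel_nn_integral ((real n - 1) / 2 + real k) (x\<^sup>2 / (4 * s\<^sup>2))"
      using nonneg by (simp add: ennreal_mult mult.assoc)
    moreover have "(real n - 1) / 2 + real k = real n / 2 + real k - 1 / 2"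
      by (simp add: diff_divide_distrib)
    moreover have "ennreal (C * d k * K k) = ennreal (exp (- l) * l ^ k / (fact k * Gamma (real n / 2 + real k)))
        * ennreal (1 / (2 * s * sqrt pi))"
      unfolding coeff using s by (intro ennreal_mult'') auto
    ultimately show ?thesis by (simp only: mult.assoc)
  qed
  have "sum_product_normal_density n \<mu>X \<sigma>X \<sigma>Y x
      = ennreal C * (\<Sum>k. ennreal (d k) * powr_bessel_K ((real n - 1) / 2 + real k) s x)"
    by (simp only: sum_product_normal_density_def C_def d_def s_def l_def)
  also have "\<dots> = (\<Sum>k. ennreal C * (ennreal (d k) * powr_bessel_K ((real n - 1) / 2 + real k) s x))"
    by (rule ennreal_suminf_cmult[symmetric])
  finally show ?thesis unfolding term_eq by (simp only: s_def l_def)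
qed

section \<open>Comparison of characteristic functions and conclusion\<close>

theorem theorem2p6:
  fixes M :: "'a measure" and N :: "'b measure"
    and X Y :: "'a \<Rightarrow> real" and Z :: "nat \<Rightarrow> 'b \<Rightarrow> real"
    and \<mu>X \<sigma>X \<sigma>Y :: real and n :: nat
  assumes "prob_space M" and "prob_space N"
    and "\<sigma>X > 0" and "\<sigma>Y > 0" and "n \<ge> 1"
    and "distributed M lborel X (normal_density \<mu>X \<sigma>X)"
    and "distributed M lborel Y (normal_density 0 \<sigma>Y)"
    and "prob_space.indep_var M borel X borel Y"
    and "prob_space.indep_vars N (\<lambda>_. borel) Z {1..n}"
    and "\<And>i. i \<in> {1..n} \<Longrightarrow> distr N borel (Z i) = distr M borel (\<lambda>\<omega>. X \<omega> * Y \<omega>)"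
  shows "distributed N lborel (\<lambda>\<omega>. \<Sum>i=1..n. Z i \<omega>) (sum_product_normal_density n \<mu>X \<sigma>X \<sigma>Y)
    \<and> (\<forall>x. x \<noteq> 0 \<or> n \<ge> 2 \<longrightarrow> sum_product_normal_density n \<mu>X \<sigma>X \<sigma>Y x < \<infinity>)"
proof -
  interpret M: prob_space M by fact
  interpret N: prob_space N by fact
  define s where "s = \<sigma>X * \<sigma>Y"
  define l where "l = real n * \<mu>X\<^sup>2 / (2 * \<sigma>X\<^sup>2)"
  define a where "a = real n / 2"
  have s: "s > 0" and l: "l \<ge> 0" and a: "a > 0"
    using assms(3-5) by (auto simp: s_def l_def a_def)
  let ?G = "density lborel (poisson_gamma_density a l)"
  let ?S = "\<lambda>\<omega>. \<Sum>i=1..n. Z i \<omega>"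
  let ?W = "distr (?G \<Otimes>\<^sub>M std_normal_distribution) borel (\<lambda>(v, y). s * sqrt (2 * v) * y)"
  have S [measurable]: "?S \<in> borel_measurable N"
    using assms(9) by (intro borel_measurable_sum) (simp add: N.indep_vars_def2)
  have density: "sum_product_normal_density n \<mu>X \<sigma>X \<sigma>Y
      = (\<lambda>x. \<integral>\<^sup>+v. poisson_gamma_density a l v * ennreal (normal_density 0 (s * sqrt (2 * v)) x) \<partial>lborel)"
    unfolding poisson_gamma_mixture_density[OF s]
    by (rule ext) (simp only: sum_product_normal_density_eq_bessel_series[OF assms(3-5)] s_def l_def a_def)
  \<comment> \<open>The integral form yields measurability without treating \<open>Lim\<close> or
    \<open>bessel_K\<close>.\<close>
  have [measurable]: "sum_product_normal_density n \<mu>X \<sigma>X \<sigma>Y \<in> borel_measurable borel"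
    unfolding density normal_density_def by measurable
  have distrX: "distr M borel X = density lborel (normal_density \<mu>X \<sigma>X)"
    using distributed_distr_eq_density[OF assms(6)]
    by (simp add: distr_cong[of M M lborel borel X X])
  have char: "char (distr N borel ?S) t = char ?W t" for t
  proof -
    define D where "D = 1 + s\<^sup>2 * t\<^sup>2"
    have D: "D > 0" by (simp add: D_def add_pos_nonneg)
    \<comment> \<open>Chosen so that \<open>exp (- c * x\<^sup>2)\<close> is the characteristic
      function at \<open>t\<close> of a centred normal with standard deviation
      \<open>\<sigma>Y * \<bar>x\<bar>\<close>, the conditional law of the product given
      \<open>X = x\<close>.\<close>
    define c where "c = (t * \<sigma>Y)\<^sup>2 / 2"
    have D': "1 + 2 * c * \<sigma>X\<^sup>2 = D"
      by (simp add: c_def D_def s_def power_mult_distrib)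
    \<comment> \<open>Since \<open>1 - D = - 2 * c * \<sigma>X\<^sup>2\<close>, the Gaussian
      exponent raised to the \<open>n\<close>-th power is the Poisson exponent.\<close>
    have e: "real n * (- c * \<mu>X\<^sup>2 / D) = l / D - l"
    proof -
      have "l / D - l = l * (1 - D) / D" using D by (simp add: field_simps)
      also have "l * (1 - D) = real n * (- c * \<mu>X\<^sup>2)"
        using assms(3) by (simp add: D'[symmetric] l_def)
      finally show ?thesis by simp
    qed
    have "char (distr M borel (\<lambda>\<omega>. X \<omega> * Y \<omega>)) t
        = of_real (LINT x|density lborel (normal_density \<mu>X \<sigma>X). exp (- (t * (\<sigma>Y * x))\<^sup>2 / 2))"
      unfolding M.distr_mult_normal[OF assms(4,7,8)] distrX
      using assms(3) by (intro char_normal_scale_mixture prob_space_normal_density) auto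
    also have "(\<lambda>x. exp (- (t * (\<sigma>Y * x))\<^sup>2 / 2)) = (\<lambda>x. exp (- c * x\<^sup>2))"
      by (simp add: c_def power_mult_distrib mult.assoc)
    also have "(LINT x|density lborel (normal_density \<mu>X \<sigma>X). exp (- c * x\<^sup>2)) = exp (- c * \<mu>X\<^sup>2 / D) / sqrt D"
      using normal_exp_square_integral[OF assms(3), of c \<mu>X] unfolding D' by (simp add: c_def)
    finally have XY: "char (distr M borel (\<lambda>\<omega>. X \<omega> * Y \<omega>)) t = of_real (exp (- c * \<mu>X\<^sup>2 / D) / sqrt D)" .
    have "char (distr N borel ?S) t = (\<Prod>i=1..n. char (distr N borel (Z i)) t)"
      by (rule N.char_distr_sum[OF assms(9)])
    also have "\<dots> = of_real ((exp (- c * \<mu>X\<^sup>2 / D) / sqrt D) ^ n)"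
      using assms(10) by (simp add: XY)
    also have "(exp (- c * \<mu>X\<^sup>2 / D) / sqrt D) ^ n = exp (real n * (- c * \<mu>X\<^sup>2 / D)) / (sqrt D) ^ n"
      by (simp only: power_divide exp_of_nat_mult)
    also have "(sqrt D) ^ n = D powr a"
      using D by (simp add: a_def powr_half_sqrt[symmetric] powr_realpow[symmetric] powr_powr)
    also note e
    finally show ?thesis
      unfolding char_poisson_gamma_mixture[OF a l] D_def .
  qed
  have "distr N borel ?S = ?W"
  proof (rule Levy_uniqueness)
    interpret G: prob_space ?G by (rule prob_space_poisson_gamma_density[OF a l])
    interpret R: prob_space std_normal_distribution by (rule prob_space_normal_density) simp
    interpret P: pair_prob_space ?G std_normal_distribution ..
    show "real_distribution (distr N borel ?S)"
      by (rule N.real_distribution_distr) measurable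
    show "real_distribution ?W"
      by (rule P.real_distribution_distr) measurable
  qed (rule ext, rule char)
  also have "\<dots> = density lborel (sum_product_normal_density n \<mu>X \<sigma>X \<sigma>Y)"
    unfolding density
  proof (rule distr_normal_scale_mixture)
    show "s * sqrt (2 * v) > 0" if "poisson_gamma_density a l v \<noteq> 0" for v
      using that s poisson_gamma_density_nonpos[of v a l] by (cases "v \<le> 0") auto
  qed measurable
  also have "distr N borel ?S = distr N lborel ?S"
    by (rule distr_cong) auto
  finally have "distr N lborel ?S = density lborel (sum_product_normal_density n \<mu>X \<sigma>X \<sigma>Y)" .
  \<comment> \<open>The condition \<open>n \<ge> 2\<close> is \<open>a \<ge> 1\<close> for
    \<open>a = n / 2\<close>.\<close>
  moreover have "sum_product_normal_density n \<mu>X \<sigma>X \<sigma>Y x < \<infinity>" if "x \<noteq> 0 \<or> n \<ge> 2" for x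
    unfolding sum_product_normal_density_eq_bessel_series[OF assms(3-5)]
    using that s l a
    by (intro poisson_gamma_bessel_series_finite) (auto simp: s_def l_def a_def)
  ultimately show ?thesis
    using S by (simp add: distributed_def)
qed

end
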